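(* Let $q\ge 2$ be an integer, let $a\in\mathbb{S}(\mathbb{C}^q)$ and let $f$ be a formal Fourier series on $\mathbb{T}$. Then the kernel $\Gamma_a[f]$ on $\mathbb{F}_q^+$ is positive definite if and only if $f$ represents a positive Radon measure on $\mathbb{T}$, i.e. there exists a positive Radon measure $\mu$ on $\mathbb{T}$ with $\widehat f(n)=\int_{\mathbb{T}}e^{-in\theta}\,d\mu(\theta)$ for all $n\in\mathbb{Z}$.
   Context: $\mathbb{T}=\mathbb{R}/2\pi\mathbb{Z}$. A formal Fourier series $f\sim\sum_{n\in\mathbb{Z}}\widehat f(n)e^{in\theta}$ is an arbitrary sequence $(\widehat f(n))_{n\in\mathbb{Z}}$ of complex numbers. $\mathbb{F}_q^+$ is the free unital semigroup on generators $s_1,\dots,s_q$ with neutral element $e$ (empty word); $|u|$ is the length of a word $u$. $\mathbb{S}(\mathbb{C}^q)=\{a=(a_1,\dots,a_q)\in\mathbb{C}^q:\sum_{k}|a_k|^2=1\}$. For $a\in\mathbb{S}(\mathbb{C}^q)$ and $w=s_{i_1}\cdots s_{i_n}$, set $[w](a)=a_{i_1}\cdots a_{i_n}$, and $[e](a)=1$. Define $\Gamma_a[f]:\mathbb{F}_q^+\times\mathbb{F}_q^+\to\mathbb{C}$ by $$\Gamma_a[f](u,v)=\begin{cases}\widehat f(|u|-|v|)\,[w](a), & u=wv \text{ for some } w\in\mathbb{F}_q^+,\\ \widehat f(|u|-|v|)\,\overline{[w](a)}, & v=wu\text{ for some } w\in\mathbb{F}_q^+,\\ 0,&\text{otherwise.}\end{cases}$$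 Positive means non-negative, and positive definite means non-negative definite: a kernel $K:X\times X\to\mathbb{C}$ is positive definite if for every finite subset $\{x_1,\dots,x_m\}\subset X$ the matrix $[K(x_i,x_j)]_{i,j}$ is Hermitian positive semidefinite. *)

theory Defs
  imports "HOL-Analysis.Analysis"
begin

section \<open>The torus\<close>

definition angle_eq :: "real \<Rightarrow> real \<Rightarrow> bool" where
  "angle_eq x y \<longleftrightarrow> (\<exists>k::int. x - y = 2 * pi * of_int k)"

lemma equivp_angle_eq: "equivp angle_eq"
proof (rule equivpI)
  show "reflp angle_eq"
    unfolding reflp_def angle_eq_def by (auto intro: exI[of _ 0])
  show "symp angle_eq"
  proof (rule sympI)
    fix x y assume "angle_eq x y"
    then obtain k :: int where "x - y = 2 * pi * of_int k" unfolding angle_eq_def by blast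
    then have "y - x = 2 * pi * of_int (- k)" by simp
    then show "angle_eq y x" unfolding angle_eq_def by blast
  qed
  show "transp angle_eq"
  proof (rule transpI)
    fix x y z assume "angle_eq x y" "angle_eq y z"
    then obtain k l :: int where "x - y = 2 * pi * of_int k" "y - z = 2 * pi * of_int l"
      unfolding angle_eq_def by blast
    then have "x - z = 2 * pi * of_int (k + l)" by (simp add: algebra_simps)
    then show "angle_eq x z" unfolding angle_eq_def by blast
  qed
qed

quotient_type torus = real / angle_eq
  by (rule equivp_angle_eq)

text \<open>The torus carries the quotient topology.\<close>

instantiation torus :: topological_space
begin

definition open_torus :: "torus set \<Rightarrow> bool" where
  "open_torus U \<longleftrightarrow> open (abs_torus -` U)"

instance
proof
  show "open (UNIV :: torus set)" by (simp add: open_torus_def)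
  show "open (S \<inter> T)" if "open S" "open T" for S T :: "torus set"
    using that by (simp add: open_torus_def vimage_Int open_Int)
  show "open (\<Union>K)" if "\<forall>S\<in>K. open S" for K :: "torus set set"
    using that unfolding open_torus_def vimage_Union by (intro open_UN) auto
qed

end

lift_definition torus_exp :: "int \<Rightarrow> torus \<Rightarrow> complex"
  is "\<lambda>n \<theta>. exp (\<i> * of_int n * of_real \<theta>)"
proof -
  fix n :: int and x y :: real assume "angle_eq x y"
  then obtain k :: int where "x - y = 2 * pi * of_int k" unfolding angle_eq_def by blast
  then have "x = y + 2 * pi * of_int k" by simp
  then have "\<i> * of_int n * of_real x
      = \<i> * of_int n * of_real y + of_int (2 * (n * k)) * pi * \<i>"
    by (simp add: algebra_simps)
  then show "exp (\<i> * of_int n * of_real x) = exp (\<i> * of_int n * of_real y)"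
    unfolding exp_eq by (metis)
qed

lemma continuous_on_abs_torus: "continuous_on UNIV abs_torus"
  unfolding continuous_on_open_vimage[OF open_UNIV] by (auto simp: open_torus_def)

lemma continuous_on_torus_exp: "continuous_on UNIV (torus_exp n)"
  unfolding continuous_on_open_vimage[OF open_UNIV]
proof (intro allI impI)
  fix B :: "complex set" assume "open B"
  have "continuous_on UNIV (\<lambda>\<theta>. exp (\<i> * of_int n * of_real \<theta>) :: complex)"
    by (intro continuous_intros)
  then have "open ((\<lambda>\<theta>. exp (\<i> * of_int n * of_real \<theta>)) -` B)"
    using \<open>open B\<close> by (simp add: open_vimage)
  moreover have "abs_torus -` (torus_exp n -` B)
      = (\<lambda>\<theta>. exp (\<i> * of_int n * of_real \<theta>)) -` B"
    by (auto simp: torus_exp.abs_eq)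
  ultimately show "open (torus_exp n -` B \<inter> UNIV)"
    by (simp add: open_torus_def)
qed

lemma inj_torus_exp_1: "inj (torus_exp 1)"
proof (rule injI)
  fix s t assume "torus_exp 1 s = torus_exp 1 t"
  then show "s = t"
  proof transfer
    fix x y :: real
    assume "exp (\<i> * of_int 1 * of_real x) = exp (\<i> * of_int 1 * of_real y)"
    then obtain k :: int where "\<i> * of_real x = \<i> * of_real y + of_int (2 * k) * pi * \<i>"
      by (auto simp: exp_eq)
    from arg_cong[OF this, of Im] show "angle_eq x y"
      unfolding angle_eq_def by (intro exI[of _ k]) simp
  qed
qed

instance torus :: t2_space
proof
  fix s t :: torus assume "s \<noteq> t"
  then have "torus_exp 1 s \<noteq> torus_exp 1 t"
    using inj_torus_exp_1 by (auto dest: injD)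
  then obtain U V where UV: "open U" "open V" "torus_exp 1 s \<in> U" "torus_exp 1 t \<in> V" "U \<inter> V = {}"
    by (rule hausdorff[THEN exE]) blast
  show "\<exists>U V. open U \<and> open V \<and> s \<in> U \<and> t \<in> V \<and> U \<inter> V = {}"
    using UV continuous_on_torus_exp[of 1]
    by (intro exI[of _ "torus_exp 1 -` U"] exI[of _ "torus_exp 1 -` V"])
       (auto simp: open_vimage)
qed


section \<open>Radon measures and Fourier coefficients\<close>

definition radon_measure :: "'a::t2_space measure \<Rightarrow> bool" where
  "radon_measure M \<longleftrightarrow>
     sets M = sets borel \<and>
     (\<forall>K. compact K \<longrightarrow> emeasure M K < \<infinity>) \<and>
     (\<forall>A\<in>sets borel. emeasure M A = (INF U\<in>{U. open U \<and> A \<subseteq> U}. emeasure M U)) \<and>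
     (\<forall>U. open U \<longrightarrow> emeasure M U = (SUP K\<in>{K. compact K \<and> K \<subseteq> U}. emeasure M K))"

text \<open>A formal Fourier series is the bare sequence of its coefficients.\<close>

type_synonym formal_fourier_series = "int \<Rightarrow> complex"

definition represents_measure :: "formal_fourier_series \<Rightarrow> torus measure \<Rightarrow> bool" where
  "represents_measure f \<mu> \<longleftrightarrow> (\<forall>n. f n = (LINT \<theta>|\<mu>. torus_exp (- n) \<theta>))"


section \<open>Positive definite kernels\<close>

text \<open>The matrix is indexed by the finite set \<open>F\<close>.  Its quadratic form is real-valued
  because the matrix is Hermitian, so taking \<open>Re\<close> loses nothing.\<close>

definition hermitian_psd_on :: "'x set \<Rightarrow> ('x \<Rightarrow> 'x \<Rightarrow> complex) \<Rightarrow> bool" where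
  "hermitian_psd_on F M \<longleftrightarrow>
     (\<forall>x\<in>F. \<forall>y\<in>F. M y x = cnj (M x y)) \<and>
     (\<forall>c. 0 \<le> Re (\<Sum>x\<in>F. \<Sum>y\<in>F. cnj (c x) * M x y * c y))"

definition positive_definite_kernel :: "('x \<Rightarrow> 'x \<Rightarrow> complex) \<Rightarrow> bool" where
  "positive_definite_kernel K \<longleftrightarrow> (\<forall>F. finite F \<longrightarrow> hermitian_psd_on F K)"


section \<open>The kernel on the free semigroup\<close>

text \<open>The generators are indexed by the finite type \<open>'q\<close> with \<open>q = CARD('q)\<close>; the free unital
  semigroup on them is \<open>'q list\<close> under concatenation, with neutral element \<open>[]\<close>.\<close>

definition unit_sphere :: "(complex ^ 'q::finite) set" where
  "unit_sphere = {a. (\<Sum>k\<in>UNIV. (cmod (a $ k))\<^sup>2) = 1}"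

definition word_eval :: "complex ^ 'q::finite \<Rightarrow> 'q list \<Rightarrow> complex" where
  "word_eval a w = (\<Prod>i\<leftarrow>w. a $ i)"

definition Gamma_kernel ::
  "complex ^ 'q::finite \<Rightarrow> formal_fourier_series \<Rightarrow> 'q list \<Rightarrow> 'q list \<Rightarrow> complex" where
  "Gamma_kernel a f u v =
     (if \<exists>w. u = w @ v then
        f (int (length u) - int (length v)) * word_eval a (THE w. u = w @ v)
      else if \<exists>w. v = w @ u then
        f (int (length u) - int (length v)) * cnj (word_eval a (THE w. v = w @ u))
      else 0)"

end

theory Submission
  imports Defs "HOL-Probability.Probability"
begin

text \<open>Write \<open>\<Gamma>\<^sub>a[f]\<close> for \<open>Gamma_kernel a f\<close> and \<open>T\<^sub>f(m, n) = f (m - n)\<close> for the Toeplitz kernel on the natural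
  numbers.  Positivity is passed around the circle: \<open>\<Gamma>\<^sub>a[f]\<close> positive definite, \<open>T\<^sub>f\<close> positive
  definite, \<open>f\<close> the Fourier coefficients of a positive measure.

  From \<open>\<Gamma>\<^sub>a[f]\<close> to \<open>T\<^sub>f\<close> (\<open>Gamma_pd_imp_Toeplitz_pd\<close>): the quadratic form of \<open>T\<^sub>f\<close> at \<open>c\<close> equals the
  quadratic form of \<open>\<Gamma>\<^sub>a[f]\<close> at \<open>u \<mapsto> c |u| [u](a)\<close>.  Indeed, a pair of words of lengths
  \<open>m\<close> and \<open>n\<close> contributes only if the shorter is a suffix of the longer, the contribution is then
  \<open>f (m - n)\<close> times \<open>|[u](a)|\<^sup>2\<close> for the longer word \<open>u\<close>, and these squares sum to
  a power of \<open>\<Sum>\<^sub>k |a\<^sub>k|\<^sup>2 = 1\<close>.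

  From \<open>T\<^sub>f\<close> to a measure (\<open>herglotz\<close>): positivity of \<open>T\<^sub>f\<close> makes the Fejer means of the formal
  series non-negative.  Normalised, they are densities of probability measures on \<open>[0, 2\<pi>]\<close>, which
  by Helly's selection theorem have a weakly convergent subsequence; its limit, projected to the
  torus and scaled, has the required coefficients.

  From a measure to \<open>\<Gamma>\<^sub>a[f]\<close> (\<open>measure_imp_Gamma_pd\<close>): the decisive case is \<open>f = 1\<close>, the unit point
  mass.  Words form a tree, in which the ancestors of a word are its suffixes; removing the root
  leaves one copy of the same tree for each letter, and an induction on the height
  shows that the quadratic form dominates \<open>|\<Sum>\<^sub>u cnj (c u) [u](a)|\<^sup>2\<close>
  (\<open>Gamma_one_lower_bound\<close>).  For general \<open>f\<close>, \<open>\<Gamma>\<^sub>a[f]\<close> is the entrywise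
  product of \<open>f (|u| - |v|)\<close> and \<open>\<Gamma>\<^sub>a[1]\<close>, hence the integral over \<open>\<theta>\<close> of the kernels obtained from
  \<open>\<Gamma>\<^sub>a[1]\<close> by the diagonal unitary change of variables \<open>c u \<mapsto> exp (i |u| \<theta>) c u\<close>.\<close>

lemma positive_definite_kernel_hermitian:
  assumes "positive_definite_kernel K"
  shows "K y x = cnj (K x y)"
proof -
  have "hermitian_psd_on {x, y} K"
    using assms by (simp add: positive_definite_kernel_def)
  then show ?thesis unfolding hermitian_psd_on_def by blast
qed

lemma positive_definite_kernel_quadratic_form:
  assumes "positive_definite_kernel K" "finite F"
  shows "0 \<le> Re (\<Sum>x\<in>F. \<Sum>y\<in>F. cnj (c x) * K x y * c y)"
  using assms unfolding positive_definite_kernel_def hermitian_psd_on_def by blast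

section \<open>The kernel on pairs of words\<close>

lemma Gamma_kernel_append_left:
  "Gamma_kernel a f (w @ v) v = f (int (length w)) * word_eval a w"
  by (simp add: Gamma_kernel_def)

lemma Gamma_kernel_append_right:
  "Gamma_kernel a f v (w @ v) = f (- int (length w)) * cnj (word_eval a w)"
  by (cases w) (auto simp: Gamma_kernel_def word_eval_def)

lemma Gamma_kernel_incomparable:
  "\<nexists>w. u = w @ v \<Longrightarrow> \<nexists>w. v = w @ u \<Longrightarrow> Gamma_kernel a f u v = 0"
  by (simp add: Gamma_kernel_def)

lemma Gamma_kernel_cases:
  obtains (left) w where "u = w @ v" | (right) w where "v = w @ u"
    | (incomparable) "\<nexists>w. u = w @ v" "\<nexists>w. v = w @ u"
  by blast

lemma word_eval_append: "word_eval a (u @ v) = word_eval a u * word_eval a v"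
  by (simp add: word_eval_def)

text \<open>This factorisation reduces the positivity of \<open>\<Gamma>\<^sub>a[f]\<close> for a measure \<open>f\<close> to that of \<open>\<Gamma>\<^sub>a[1]\<close>.\<close>

lemma Gamma_kernel_Schur:
  "Gamma_kernel a f u v = f (int (length u) - int (length v)) * Gamma_kernel a (\<lambda>_. 1) u v"
  by (cases u v rule: Gamma_kernel_cases)
    (simp_all add: Gamma_kernel_append_left Gamma_kernel_append_right Gamma_kernel_incomparable)

lemma Gamma_kernel_hermitian:
  assumes "\<And>n. f (- n) = cnj (f n)"
  shows "Gamma_kernel a f v u = cnj (Gamma_kernel a f u v)"
  by (cases u v rule: Gamma_kernel_cases)
    (simp_all add: Gamma_kernel_append_left Gamma_kernel_append_right
       Gamma_kernel_incomparable assms)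

lemma Gamma_kernel_append_same:
  "Gamma_kernel a (\<lambda>_. 1) (u @ x) (v @ x) = Gamma_kernel a (\<lambda>_. 1) u v"
proof (cases u v rule: Gamma_kernel_cases)
  case (left w)
  then show ?thesis
    using Gamma_kernel_append_left[of a "\<lambda>_. 1" w "v @ x"] by (simp add: Gamma_kernel_append_left)
next
  case (right w)
  then show ?thesis
    using Gamma_kernel_append_right[of a "\<lambda>_. 1" "u @ x" w] by (simp add: Gamma_kernel_append_right)
next
  case incomparable
  then show ?thesis
    by (subst (1 2) Gamma_kernel_incomparable) (simp_all flip: append_assoc)
qed

text \<open>The subtrees rooted at the one-letter words are pairwise orthogonal for \<open>\<Gamma>\<^sub>a[1]\<close>, and each of them
  carries a copy of the whole kernel: two words ending in different letters are incomparable,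
  and a common last letter does not affect which word is a suffix of the other.\<close>

lemma Gamma_kernel_snoc:
  "Gamma_kernel a (\<lambda>_. 1) (u @ [i]) (v @ [j]) = (if i = j then Gamma_kernel a (\<lambda>_. 1) u v else 0)"
proof (cases "i = j")
  case True
  then show ?thesis by (simp add: Gamma_kernel_append_same)
next
  case False
  then show ?thesis
    by (subst Gamma_kernel_incomparable) (simp_all flip: append_assoc)
qed

text \<open>Among the words \<open>v\<close> of a given length not exceeding that of \<open>u\<close>, only one pairs non-trivially with \<open>u\<close>.
  This collapses one of the two sums in \<open>Gamma_kernel_levels\<close>.\<close>

lemma Gamma_kernel_not_suffix:
  assumes "length v \<le> length u" "v \<noteq> drop (length u - length v) u"
  shows "Gamma_kernel a f u v = 0" "Gamma_kernel a f v u = 0"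
proof -
  have "\<nexists>w. u = w @ v" using assms by auto
  moreover have "\<nexists>w. v = w @ u" using assms by auto
  ultimately show "Gamma_kernel a f u v = 0" "Gamma_kernel a f v u = 0"
    by (simp_all add: Gamma_kernel_incomparable)
qed

section \<open>From the free semigroup to Toeplitz kernels\<close>

lemma finite_words_length: "finite {u :: 'q::finite list. length u = m}"
  using finite_lists_length_eq[of "UNIV :: 'q set" m] by simp

lemma sum_word_eval_sphere:
  assumes "(a :: complex ^ 'q::finite) \<in> unit_sphere"
  shows "(\<Sum>u | length u = m. (cmod (word_eval a u))\<^sup>2) = 1"
proof (induction m)
  case 0
  then show ?case by (simp add: word_eval_def)
next
  case (Suc m)
  have words: "{u :: 'q list. length u = Suc m} = (\<lambda>(i, u). i # u) ` (UNIV \<times> {u. length u = m})"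
    by (auto simp: length_Suc_conv image_iff)
  have "(\<Sum>u :: 'q list | length u = Suc m. (cmod (word_eval a u))\<^sup>2)
      = (\<Sum>(i, u) \<in> UNIV \<times> {u. length u = m}. (cmod (a $ i))\<^sup>2 * (cmod (word_eval a u))\<^sup>2)"
    unfolding words
    by (subst sum.reindex)
      (auto simp: inj_on_def word_eval_def norm_mult power_mult_distrib intro!: sum.cong)
  also have "\<dots> = (\<Sum>i\<in>UNIV. (cmod (a $ i))\<^sup>2) * (\<Sum>u | length u = m. (cmod (word_eval a u))\<^sup>2)"
    by (simp add: sum_product sum.cartesian_product)
  also have "\<dots> = 1" using Suc assms by (simp add: unit_sphere_def)
  finally show ?case .
qed

text \<open>Each summand with \<open>v\<close> a suffix of \<open>u = w @ v\<close> is \<open>f (m - n)\<close> times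
  \<open>cnj [w](a) cnj [v](a) [w](a) [v](a) = |[u](a)|\<^sup>2\<close>, so that the longer word determines the term, and
  \<open>sum_word_eval_sphere\<close> evaluates the sum over it.  The case where \<open>u\<close> is the shorter word is
  the mirror image.\<close>

lemma Gamma_kernel_levels:
  fixes a :: "complex ^ 'q::finite"
  assumes "a \<in> unit_sphere"
  shows "(\<Sum>u | length u = m. \<Sum>v | length v = n.
      cnj (word_eval a u) * Gamma_kernel a f u v * word_eval a v) = f (int m - int n)"
    (is "(\<Sum>u | _ u. \<Sum>v | _ v. ?t u v) = _")
proof (cases "n \<le> m")
  case True
  have "(\<Sum>v | length v = n. ?t u v) = f (int m - int n) * of_real ((cmod (word_eval a u))\<^sup>2)"
    if "length u = m" for u :: "'q list"
  proof -
    define w v0 where "w = take (m - n) u" and "v0 = drop (m - n) u"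
    have u: "u = w @ v0" "length v0 = n" "length w = m - n"
      using that True by (simp_all add: w_def v0_def)
    have "?t u v = 0" if "length v = n" "v \<noteq> v0" for v
      using that \<open>length u = m\<close> True by (simp add: Gamma_kernel_not_suffix v0_def)
    then have "(\<Sum>v | length v = n. ?t u v) = (\<Sum>v\<in>{v0}. ?t u v)"
      using u by (intro sum.mono_neutral_right) (auto simp: finite_words_length)
    also have "\<dots> = f (int m - int n) * of_real ((cmod (word_eval a u))\<^sup>2)"
      using u True
      by (simp add: Gamma_kernel_append_left word_eval_append complex_norm_square of_nat_diff mult_ac del: of_real_power)
    finally show ?thesis .
  qed
  then have "(\<Sum>u | length u = m. \<Sum>v | length v = n. ?t u v)
      = (\<Sum>u :: 'q list | length u = m. f (int m - int n) * of_real ((cmod (word_eval a u))\<^sup>2))"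
    by (intro sum.cong) auto
  also have "\<dots> = f (int m - int n)"
    using sum_word_eval_sphere[OF assms, of m]
    by (simp only: flip: sum_distrib_left of_real_sum) simp
  finally show ?thesis .
next
  case False
  have "(\<Sum>u | length u = m. ?t u v) = f (int m - int n) * of_real ((cmod (word_eval a v))\<^sup>2)"
    if "length v = n" for v :: "'q list"
  proof -
    define w u0 where "w = take (n - m) v" and "u0 = drop (n - m) v"
    have v: "v = w @ u0" "length u0 = m" "length w = n - m"
      using that False by (simp_all add: w_def u0_def)
    have "?t u v = 0" if "length u = m" "u \<noteq> u0" for u
      using that \<open>length v = n\<close> False by (simp add: Gamma_kernel_not_suffix u0_def)
    then have "(\<Sum>u | length u = m. ?t u v) = (\<Sum>u\<in>{u0}. ?t u v)"
      using v by (intro sum.mono_neutral_right) (auto simp: finite_words_length)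
    also have "\<dots> = f (int m - int n) * of_real ((cmod (word_eval a v))\<^sup>2)"
      using v False
      by (simp add: Gamma_kernel_append_right word_eval_append complex_norm_square of_nat_diff mult_ac del: of_real_power)
    finally show ?thesis .
  qed
  then have "(\<Sum>v | length v = n. \<Sum>u | length u = m. ?t u v)
      = (\<Sum>v :: 'q list | length v = n. f (int m - int n) * of_real ((cmod (word_eval a v))\<^sup>2))"
    by (intro sum.cong) auto
  also have "\<dots> = f (int m - int n)"
    using sum_word_eval_sphere[OF assms, of n]
    by (simp only: flip: sum_distrib_left of_real_sum) simp
  finally show ?thesis by (subst sum.swap)
qed

text \<open>Testing the kernel on vectors that are radial multiples of \<open>u \<mapsto> [u](a)\<close> recovers the Toeplitz
  form exactly, by \<open>Gamma_kernel_levels\<close>.\<close>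

lemma Gamma_pd_imp_Toeplitz_pd:
  fixes a :: "complex ^ 'q::finite"
  assumes a: "a \<in> unit_sphere" and pd: "positive_definite_kernel (Gamma_kernel a f)"
  shows "positive_definite_kernel (\<lambda>m n :: nat. f (int m - int n))"
  unfolding positive_definite_kernel_def hermitian_psd_on_def
proof (intro allI impI conjI ballI)
  have herm: "Gamma_kernel a f v u = cnj (Gamma_kernel a f u v)" for u v
    by (rule positive_definite_kernel_hermitian[OF pd])
  show "f (int n - int m) = cnj (f (int m - int n))" for m n
  proof -
    have "cnj (f (int m - int n)) = (\<Sum>u :: 'q list | length u = m. \<Sum>v | length v = n.
        cnj (word_eval a v) * Gamma_kernel a f v u * word_eval a u)"
      unfolding Gamma_kernel_levels[OF a, where f = f and m = m and n = n, symmetric] cnj_sum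
      by (intro sum.cong refl) (simp add: herm[symmetric] mult_ac)
    also have "\<dots> = f (int n - int m)"
      by (subst sum.swap) (rule Gamma_kernel_levels[OF a])
    finally show ?thesis by simp
  qed
next
  fix F :: "nat set" and c :: "nat \<Rightarrow> complex"
  assume F: "finite F"
  define W :: "'q list set" where "W = (\<Union>m\<in>F. {u. length u = m})"
  define d where "d u = word_eval a u * c (length u)" for u
  have W: "(\<Sum>u\<in>W. g u) = (\<Sum>m\<in>F. \<Sum>u | length u = m. g u)" for g :: "'q list \<Rightarrow> complex"
    unfolding W_def by (rule sum.UNION_disjoint) (use F finite_words_length in auto)
  have "finite W" unfolding W_def using F finite_words_length by auto
  then have "0 \<le> Re (\<Sum>u\<in>W. \<Sum>v\<in>W. cnj (d u) * Gamma_kernel a f u v * d v)"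
    by (rule positive_definite_kernel_quadratic_form[OF pd])
  also have "(\<Sum>u\<in>W. \<Sum>v\<in>W. cnj (d u) * Gamma_kernel a f u v * d v)
      = (\<Sum>m\<in>F. \<Sum>n\<in>F. \<Sum>u | length u = m. \<Sum>v | length v = n.
          cnj (d u) * Gamma_kernel a f u v * d v)"
    unfolding W by (rule sum.cong[OF refl]) (rule sum.swap)
  also have "\<dots> = (\<Sum>m\<in>F. \<Sum>n\<in>F. cnj (c m) * c n * (\<Sum>u | length u = m. \<Sum>v | length v = n.
          cnj (word_eval a u) * Gamma_kernel a f u v * word_eval a v))"
    unfolding sum_distrib_left d_def
    by (rule sum.cong[OF refl], rule sum.cong[OF refl], rule sum.cong[OF refl], rule sum.cong[OF refl]) (auto simp: mult_ac)
  also have "\<dots> = (\<Sum>m\<in>F. \<Sum>n\<in>F. cnj (c m) * f (int m - int n) * c n)"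
    unfolding Gamma_kernel_levels[OF a] by (intro sum.cong refl) (simp add: mult_ac)
  finally show "0 \<le> Re (\<Sum>m\<in>F. \<Sum>n\<in>F. cnj (c m) * f (int m - int n) * c n)" .
qed

section \<open>Positivity of the kernel of a point mass\<close>

text \<open>The row \<open>a\<close> is a contraction; this is the Cauchy-Schwarz inequality.\<close>

lemma norm_sq_row_combination_le:
  fixes a :: "complex ^ 'q::finite"
  assumes "a \<in> unit_sphere"
  shows "(cmod (\<Sum>i\<in>UNIV. a $ i * z i))\<^sup>2 \<le> (\<Sum>i\<in>UNIV. (cmod (z i))\<^sup>2)"
proof -
  have "cmod (\<Sum>i\<in>UNIV. a $ i * z i) \<le> (\<Sum>i\<in>UNIV. \<bar>cmod (a $ i)\<bar> * \<bar>cmod (z i)\<bar>)"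
    by (rule order_trans[OF norm_sum]) (simp add: norm_mult)
  also have "\<dots> \<le> L2_set (\<lambda>i. cmod (a $ i)) UNIV * L2_set (\<lambda>i. cmod (z i)) UNIV"
    by (rule L2_set_mult_ineq)
  also have "\<dots> = sqrt (\<Sum>i\<in>UNIV. (cmod (z i))\<^sup>2)"
    using assms by (simp add: unit_sphere_def L2_set_def)
  finally have "(cmod (\<Sum>i\<in>UNIV. a $ i * z i))\<^sup>2 \<le> (sqrt (\<Sum>i\<in>UNIV. (cmod (z i))\<^sup>2))\<^sup>2"
    by (rule power_mono) simp
  then show ?thesis by (simp add: sum_nonneg)
qed

lemma finite_words_less: "finite {u :: 'q::finite list. length u < N}"
proof -
  have "{u :: 'q list. length u < N} = (\<Union>m<N. {u. length u = m})" by auto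
  then show ?thesis by (simp add: finite_words_length)
qed

text \<open>A word is split at its last letter because the kernel compares suffixes: the words ending in \<open>i\<close>
  form the subtree rooted at the one-letter word \<open>[i]\<close>.\<close>

lemma sum_words_snoc:
  fixes g :: "'q::finite list \<Rightarrow> 'b::comm_monoid_add"
  shows "(\<Sum>u | length u < Suc N. g u) = g [] + (\<Sum>i\<in>UNIV. \<Sum>u | length u < N. g (u @ [i]))"
proof -
  have words: "{u :: 'q list. length u < Suc N} =
      insert [] ((\<lambda>(i, u). u @ [i]) ` (UNIV \<times> {u. length u < N}))" (is "_ = insert [] ?S")
  proof -
    have "u \<in> ?S" if "length u < Suc N" "u \<noteq> []" for u
      using that by (cases u rule: rev_cases) (auto simp: image_iff)
    then show ?thesis by auto
  qed
  have "finite ?S" by (simp add: finite_words_less)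
  then have "(\<Sum>u | length u < Suc N. g u) = g [] + sum g ?S"
    unfolding words by (subst sum.insert) auto
  also have "sum g ?S = (\<Sum>(i, u)\<in>UNIV \<times> {u. length u < N}. g (u @ [i]))"
    by (subst sum.reindex) (auto simp: inj_on_def intro!: sum.cong)
  finally show ?thesis by (simp add: sum.cartesian_product)
qed

text \<open>Plain non-negativity of the form is too weak for the induction, since the root interacts with
  all its descendants.  Let \<open>Q\<close> denote the form, \<open>L\<close> the linear functional on the left-hand side, and
  \<open>s i\<close> the restriction of \<open>c\<close> to the \<open>i\<close>-th subtree.  Then \<open>Q c = |c []|\<^sup>2 + 2 Re (z * c []) + (\<Sum>\<^sub>i Q (s i))\<close>
  and \<open>L c = cnj (c []) + z\<close> with \<open>z = (\<Sum>\<^sub>i a\<^sub>i * L (s i))\<close>, so that the bound for \<open>Q c\<close> amounts to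
  \<open>|z|\<^sup>2 \<le> (\<Sum>\<^sub>i Q (s i))\<close>.  This follows from the induction hypothesis and \<open>norm_sq_row_combination_le\<close>.\<close>

lemma Gamma_one_lower_bound:
  fixes a :: "complex ^ 'q::finite"
  assumes "a \<in> unit_sphere"
  shows "(cmod (\<Sum>u | length u < N. cnj (c u) * word_eval a u))\<^sup>2
    \<le> Re (\<Sum>u | length u < N. \<Sum>v | length v < N. cnj (c u) * Gamma_kernel a (\<lambda>_. 1) u v * c v)"
proof (induction N arbitrary: c)
  case 0
  show ?case by simp
next
  case (Suc N)
  let ?K = "Gamma_kernel a (\<lambda>_. 1)"
  define L where "L c = (\<Sum>u | length u < N. cnj (c u) * word_eval a u)" for c
  define Q where "Q c = (\<Sum>u | length u < N. \<Sum>v | length v < N. cnj (c u) * ?K u v * c v)" for c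
  define s where "s i = (\<lambda>u. c (u @ [i]))" for i
  define z where "z = (\<Sum>i\<in>UNIV. a $ i * L (s i))"
  have K_left: "?K u [] = word_eval a u" and K_right: "?K [] u = cnj (word_eval a u)" for u
    using Gamma_kernel_append_left[of a "\<lambda>_. 1" u "[]"]
      Gamma_kernel_append_right[of a "\<lambda>_. 1" "[]" u] by simp_all
  have snoc: "word_eval a (u @ [i]) = a $ i * word_eval a u" for u i
    by (simp add: word_eval_def)
  have nil: "word_eval a [] = 1" by (simp add: word_eval_def)
  have L: "(\<Sum>u | length u < Suc N. cnj (c u) * word_eval a u) = cnj (c []) + z"
    unfolding sum_words_snoc
    by (simp add: z_def L_def s_def snoc nil sum_distrib_left mult_ac)
  have zl: "(\<Sum>i\<in>UNIV. \<Sum>u | length u < N. cnj (c (u @ [i])) * word_eval a (u @ [i]) * c []) = z * c []"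
    by (simp add: z_def L_def s_def snoc sum_distrib_left sum_distrib_right mult_ac)
  have zr: "(\<Sum>i\<in>UNIV. \<Sum>u | length u < N. cnj (c []) * cnj (word_eval a (u @ [i])) * c (u @ [i])) = cnj (z * c [])"
    unfolding zl[symmetric] by (simp add: cnj_sum mult_ac)
  \<comment> \<open>Subtrees below different letters do not interact.\<close>
  have diag: "(\<Sum>u | length u < N. \<Sum>j\<in>UNIV. \<Sum>v | length v < N.
      cnj (c (u @ [i])) * ?K (u @ [i]) (v @ [j]) * c (v @ [j])) = Q (s i)" for i
  proof -
    have "(\<Sum>j\<in>UNIV. \<Sum>v | length v < N. cnj (c (u @ [i])) * ?K (u @ [i]) (v @ [j]) * c (v @ [j]))
      = (\<Sum>j\<in>UNIV. if i = j then \<Sum>v | length v < N. cnj (s i u) * ?K u v * s i v else 0)" for u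
      by (intro sum.cong refl) (auto simp: Gamma_kernel_snoc s_def)
    then show ?thesis by (simp add: Q_def)
  qed
  have Q: "(\<Sum>u | length u < Suc N. \<Sum>v | length v < Suc N. cnj (c u) * ?K u v * c v)
      = cnj (c []) * c [] + cnj (z * c []) + (z * c [] + (\<Sum>i\<in>UNIV. Q (s i)))"
    unfolding sum_words_snoc K_left K_right sum.distrib zl zr diag by (simp add: nil)
  have "(cmod z)\<^sup>2 \<le> (\<Sum>i\<in>UNIV. (cmod (L (s i)))\<^sup>2)"
    unfolding z_def by (rule norm_sq_row_combination_le) fact
  also have "\<dots> \<le> (\<Sum>i\<in>UNIV. Re (Q (s i)))"
    unfolding L_def Q_def by (intro sum_mono Suc.IH)
  finally have "(cmod z)\<^sup>2 \<le> Re (\<Sum>i\<in>UNIV. Q (s i))" by simp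
  moreover have "(cmod (cnj (c []) + z))\<^sup>2 = Re (cnj (c []) * c [] + cnj (z * c []) + z * c []) + (cmod z)\<^sup>2"
    unfolding cmod_power2 by (simp add: power2_eq_square algebra_simps)
  ultimately show ?case unfolding L Q by simp
qed

lemma Gamma_one_pd:
  fixes a :: "complex ^ 'q::finite"
  assumes "a \<in> unit_sphere"
  shows "positive_definite_kernel (Gamma_kernel a (\<lambda>_. 1))"
  unfolding positive_definite_kernel_def hermitian_psd_on_def
proof (intro allI impI conjI ballI)
  show "Gamma_kernel a (\<lambda>_. 1) v u = cnj (Gamma_kernel a (\<lambda>_. 1) u v)" for u v
    by (rule Gamma_kernel_hermitian) simp
next
  fix F :: "'q list set" and c :: "'q list \<Rightarrow> complex"
  assume F: "finite F"
  define N where "N = Suc (Max (length ` F))"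
  \<comment> \<open>Extend the test vector by zero to all words of bounded length.\<close>
  define d where "d u = (if u \<in> F then c u else 0)" for u
  have sub: "F \<subseteq> {u. length u < N}"
    using F by (auto simp: N_def less_Suc_eq_le)
  have "0 \<le> Re (\<Sum>u | length u < N. \<Sum>v | length v < N. cnj (d u) * Gamma_kernel a (\<lambda>_. 1) u v * d v)"
    using Gamma_one_lower_bound[OF assms] order_trans zero_le_power2 by blast
  also have "(\<Sum>u | length u < N. \<Sum>v | length v < N. cnj (d u) * Gamma_kernel a (\<lambda>_. 1) u v * d v)
      = (\<Sum>u\<in>F. \<Sum>v | length v < N. cnj (d u) * Gamma_kernel a (\<lambda>_. 1) u v * d v)"
    by (rule sum.mono_neutral_right) (use sub in \<open>auto simp: finite_words_less d_def\<close>)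
  also have "\<dots> = (\<Sum>u\<in>F. \<Sum>v\<in>F. cnj (d u) * Gamma_kernel a (\<lambda>_. 1) u v * d v)"
    by (intro sum.cong refl sum.mono_neutral_right) (use sub in \<open>auto simp: finite_words_less d_def\<close>)
  finally show "0 \<le> Re (\<Sum>u\<in>F. \<Sum>v\<in>F. cnj (c u) * Gamma_kernel a (\<lambda>_. 1) u v * c v)"
    by (simp add: d_def)
qed

section \<open>Characters of the torus\<close>

lemma compact_torus: "compact (UNIV :: torus set)"
proof -
  have "t \<in> abs_torus ` {0..2 * pi}" for t
  proof -
    obtain x where t: "t = abs_torus x" 
      using torus.abs_induct[of "\<lambda>t. \<exists>x. t = abs_torus x" t] by auto
    define y where "y = x - 2 * pi * of_int \<lfloor>x / (2 * pi)\<rfloor>"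
    have "angle_eq x y" unfolding angle_eq_def y_def by auto
    moreover have "y = 2 * pi * frac (x / (2 * pi))"
      by (simp add: y_def frac_def field_simps)
    then have "y \<in> {0..2 * pi}"
      using frac_lt_1[of "x / (2 * pi)"] by (auto simp: mult_le_cancel_left1 intro: less_imp_le)
    ultimately show ?thesis using t torus.abs_eq_iff by blast
  qed
  then have "(UNIV :: torus set) = abs_torus ` {0..2 * pi}" by auto
  then show ?thesis
    by (metis compact_Icc compact_continuous_image continuous_on_abs_torus continuous_on_subset subset_UNIV)
qed

lemma torus_exp_measurable: "torus_exp n \<in> borel_measurable borel"
  by (rule borel_measurable_continuous_onI) (rule continuous_on_torus_exp)

lemma norm_torus_exp: "norm (torus_exp n t) = 1"
  by transfer (simp add: norm_exp_eq_Re)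

lemma cnj_torus_exp: "cnj (torus_exp n t) = torus_exp (- n) t"
  by transfer (simp add: exp_cnj)

lemma torus_exp_add: "torus_exp (m + n) t = torus_exp m t * torus_exp n t"
  by transfer (simp add: algebra_simps flip: exp_add)

lemma torus_exp_integrable:
  assumes "radon_measure \<mu>"
  shows "integrable \<mu> (torus_exp n)"
proof -
  have sets: "sets \<mu> = sets borel" and "\<forall>K. compact K \<longrightarrow> emeasure \<mu> K < \<infinity>"
    using assms unfolding radon_measure_def by - (elim conjE, assumption)+
  then have fin: "emeasure \<mu> UNIV < \<infinity>" using compact_torus by blast
  have "space \<mu> = UNIV" using sets_eq_imp_space_eq[OF sets] by simp
  then interpret finite_measure \<mu> using fin by (intro finite_measureI) auto
  have "torus_exp n \<in> borel_measurable \<mu>"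
    using torus_exp_measurable measurable_cong_sets[OF sets refl] by blast
  then show ?thesis by (intro integrable_const_bound[of _ 1]) (auto simp: norm_torus_exp)
qed

section \<open>From measures to positive definite kernels\<close>

text \<open>The functions \<open>q\<close> below are the quadratic forms of \<open>\<Gamma>\<^sub>a[1]\<close> at the rotated vectors
  \<open>u \<mapsto> exp (i |u| \<theta>) c u\<close>; the form of \<open>\<Gamma>\<^sub>a[f]\<close> is their integral.\<close>

lemma measure_imp_Gamma_pd:
  fixes a :: "complex ^ 'q::finite"
  assumes a: "a \<in> unit_sphere" and \<mu>: "radon_measure \<mu>" and f: "represents_measure f \<mu>"
  shows "positive_definite_kernel (Gamma_kernel a f)"
  unfolding positive_definite_kernel_def hermitian_psd_on_def
proof (intro allI impI conjI ballI)
  note fint = f[unfolded represents_measure_def, rule_format]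
  note int [simp] = torus_exp_integrable[OF \<mu>]
  have "f (- n) = cnj (f n)" for n
  proof -
    have "f (- n) = (LINT t|\<mu>. cnj (torus_exp (- n) t))"
      unfolding fint cnj_torus_exp ..
    also have "\<dots> = cnj (f n)" unfolding fint by (rule Bochner_Integration.integral_cnj)
    finally show ?thesis .
  qed
  then show "Gamma_kernel a f v u = cnj (Gamma_kernel a f u v)" for u v
    by (rule Gamma_kernel_hermitian)
next
  note fint = f[unfolded represents_measure_def, rule_format]
  note int [simp] = torus_exp_integrable[OF \<mu>]
  fix F :: "'q list set" and c :: "'q list \<Rightarrow> complex"
  assume F: "finite F"
  let ?K = "Gamma_kernel a (\<lambda>_. 1)"
  define q where "q t = (\<Sum>u\<in>F. \<Sum>v\<in>F. cnj (torus_exp (int (length u)) t * c u) * ?K u v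
      * (torus_exp (int (length v)) t * c v))" for t
  have q: "q t = (\<Sum>u\<in>F. \<Sum>v\<in>F. (cnj (c u) * ?K u v * c v)
      * torus_exp (- (int (length u) - int (length v))) t)" for t
  proof -
    have "torus_exp (- (int (length u) - int (length v))) t
        = cnj (torus_exp (int (length u)) t) * torus_exp (int (length v)) t" for u v :: "'q list"
      using torus_exp_add[of "- int (length u)" "int (length v)" t] by (simp add: cnj_torus_exp)
    then show ?thesis by (simp only: q_def complex_cnj_mult mult_ac)
  qed
  have "(\<Sum>u\<in>F. \<Sum>v\<in>F. cnj (c u) * Gamma_kernel a f u v * c v)
      = (\<Sum>u\<in>F. \<Sum>v\<in>F. (cnj (c u) * ?K u v * c v) * f (int (length u) - int (length v)))"
    by (subst Gamma_kernel_Schur) (simp only: mult_ac)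
  also have "\<dots> = (LINT t|\<mu>. q t)"
    unfolding q fint by (simp del: minus_diff_eq)
  finally have "Re (\<Sum>u\<in>F. \<Sum>v\<in>F. cnj (c u) * Gamma_kernel a f u v * c v) = (LINT t|\<mu>. Re (q t))"
    unfolding q by (simp del: minus_diff_eq flip: integral_Re)
  also have "\<dots> \<ge> 0"
    unfolding q_def
    by (intro integral_nonneg_AE AE_I2 positive_definite_kernel_quadratic_form Gamma_one_pd a F)
  finally show "0 \<le> Re (\<Sum>u\<in>F. \<Sum>v\<in>F. cnj (c u) * Gamma_kernel a f u v * c v)" .
qed

section \<open>Radon measures from measures on the line\<close>

text \<open>On a Polish space a finite Borel measure is inner regular by compact sets.  Continuous images of
  compact sets are compact, so inner regularity passes to the image measure, for every Borel set.
  Outer regularity then follows by taking complements, since a compact set in a Hausdorff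
  space is closed and the measure is finite.\<close>

lemma radon_measure_distr:
  fixes M :: "'a::{second_countable_topology, complete_space} measure"
    and g :: "'a \<Rightarrow> 'b::t2_space"
  assumes sets: "sets M = sets borel" and fin: "finite_measure M"
    and cont: "continuous_on UNIV g"
  shows "radon_measure (distr M borel g)"
proof -
  let ?N = "distr M borel g"
  interpret finite_measure M by fact
  have space: "space M = UNIV" using sets_eq_imp_space_eq[OF sets] by simp
  have g: "g \<in> measurable M borel"
    using borel_measurable_continuous_onI[OF cont] measurable_cong_sets[OF sets refl] by blast
  interpret N: finite_measure ?N by (rule finite_measure_distr) fact
  have emeasure_N: "emeasure ?N A = emeasure M (g -` A)" if "A \<in> sets borel" for A
    using that g space by (simp add: emeasure_distr)
  have inner: "emeasure ?N A = (SUP K\<in>{K. compact K \<and> K \<subseteq> A}. emeasure ?N K)"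
    if A: "A \<in> sets borel" for A
  proof (rule antisym)
    have vA: "g -` A \<in> sets borel" using measurable_sets[OF g A] space sets by simp
    have "emeasure ?N A = (SUP K\<in>{K. K \<subseteq> g -` A \<and> compact K}. emeasure M K)"
      unfolding emeasure_N[OF A] using inner_regular[OF sets _ vA] by simp
    also have "\<dots> \<le> (SUP K\<in>{K. compact K \<and> K \<subseteq> A}. emeasure ?N K)"
    proof (rule SUP_mono)
      fix K assume K: "K \<in> {K. K \<subseteq> g -` A \<and> compact K}"
      then have comp: "compact (g ` K)"
        using cont by (auto intro: compact_continuous_image continuous_on_subset)
      then have "g ` K \<in> sets borel" by (simp add: borel_closed compact_imp_closed)
      then have "emeasure M K \<le> emeasure ?N (g ` K)"
        unfolding emeasure_N[OF \<open>g ` K \<in> _\<close>]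
        using measurable_sets[OF g] space by (intro emeasure_mono) auto
      then show "\<exists>K'\<in>{K. compact K \<and> K \<subseteq> A}. emeasure M K \<le> emeasure ?N K'"
        using K comp by (intro bexI[of _ "g ` K"]) auto
    qed
    finally show "emeasure ?N A \<le> (SUP K\<in>{K. compact K \<and> K \<subseteq> A}. emeasure ?N K)" .
    show "(SUP K\<in>{K. compact K \<and> K \<subseteq> A}. emeasure ?N K) \<le> emeasure ?N A"
      using A by (intro SUP_least emeasure_mono) auto
  qed
  have outer: "emeasure ?N A = (INF U\<in>{U. open U \<and> A \<subseteq> U}. emeasure ?N U)"
    if A: "A \<in> sets borel" for A
  proof (rule antisym)
    show "emeasure ?N A \<le> (INF U\<in>{U. open U \<and> A \<subseteq> U}. emeasure ?N U)"
      using A by (intro INF_greatest emeasure_mono) auto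
    show "(INF U\<in>{U. open U \<and> A \<subseteq> U}. emeasure ?N U) \<le> emeasure ?N A"
    proof (rule ennreal_le_epsilon)
      fix e :: real assume "0 < e"
      have "\<exists>K. compact K \<and> K \<subseteq> - A \<and> measure ?N (- A) < measure ?N K + e"
      \<comment> \<open>If \<open>- A\<close> is null, the strict bound below the supremum is not available: \<open>ennreal\<close> truncates.\<close>
      proof (cases "measure ?N (- A) = 0")
        case True
        then show ?thesis using \<open>0 < e\<close> by (intro exI[of _ "{}"]) auto
      next
        case False
        then have "ennreal (measure ?N (- A) - e) < emeasure ?N (- A)"
          unfolding N.emeasure_eq_measure using \<open>0 < e\<close> by (intro ennreal_lessI) (auto simp: zero_less_measure_iff)
        also have "emeasure ?N (- A) = (SUP K\<in>{K. compact K \<and> K \<subseteq> - A}. emeasure ?N K)"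
          using A by (intro inner) auto
        finally obtain K where K: "compact K" "K \<subseteq> - A"
          "ennreal (measure ?N (- A) - e) < ennreal (measure ?N K)"
          unfolding less_SUP_iff N.emeasure_eq_measure by auto
        from K(3) have "measure ?N (- A) - e < measure ?N K"
          by (meson ennreal_leI not_le)
        then show ?thesis using K by (intro exI[of _ K]) auto
      qed
      then obtain K where K: "compact K" "K \<subseteq> - A" "measure ?N (- A) < measure ?N K + e" by blast
      have Kb: "K \<in> sets ?N" and Ab: "A \<in> sets ?N" using K A by (auto simp: borel_closed compact_imp_closed)
      have "measure ?N (- K) < measure ?N A + e"
        using K(3) N.finite_measure_compl[OF Kb] N.finite_measure_compl[OF Ab] by (simp add: Compl_eq_Diff_UNIV)
      then have "emeasure ?N (- K) \<le> emeasure ?N A + e"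
        using \<open>0 < e\<close> by (simp add: N.emeasure_eq_measure flip: ennreal_plus)
      moreover have "(INF U\<in>{U. open U \<and> A \<subseteq> U}. emeasure ?N U) \<le> emeasure ?N (- K)"
        using K by (intro INF_lower) (auto simp: open_Compl compact_imp_closed)
      ultimately show "(INF U\<in>{U. open U \<and> A \<subseteq> U}. emeasure ?N U) \<le> emeasure ?N A + e" by order
    qed
  qed
  show ?thesis
    unfolding radon_measure_def
  proof (intro conjI allI impI ballI)
    show "emeasure ?N K < \<infinity>" for K
      by (simp add: N.emeasure_eq_measure)
  qed (simp, erule outer, rule inner, erule borel_open)
qed

section \<open>Fejer means\<close>

lemma integral_trig_period:
  "(LINT x:{0..2 * pi}|lborel. exp (\<i> * of_int k * of_real x)) = (if k = 0 then 2 * pi else 0)"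
proof (cases "k = 0")
  case True
  have "(LINT x:{0..2 * pi}|lborel. (1 :: complex)) = of_real (2 * pi)"
    by (simp add: set_lebesgue_integral_def scaleR_conv_of_real)
  then show ?thesis using True by simp
next
  case False
  define F where "F x = exp (\<i> * of_int k * of_real x) / (\<i> * of_int k)" for x :: real
  have deriv: "(F has_vector_derivative exp (\<i> * of_int k * of_real x)) (at x within {0..2 * pi})" for x
    unfolding F_def using False
    by (auto intro!: derivative_eq_intros has_vector_derivative_real_field)
  have "(LINT x:{0..2 * pi}|lborel. exp (\<i> * of_int k * of_real x)) = F (2 * pi) - F 0"
    unfolding set_lebesgue_integral_def
    by (rule integral_FTC_atLeastAtMost) (auto intro!: deriv continuous_intros)
  also have "exp (\<i> * of_int k * of_real (2 * pi)) = exp (of_int (2 * k) * of_real pi * \<i> + 0)"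
    by (simp add: mult_ac)
  then have "F (2 * pi) - F 0 = 0"
    by (simp add: F_def exp_eq_1 mult_ac)
  finally show ?thesis using False by simp
qed

lemma card_diff_eq:
  "card {(m, n). m < N \<and> n < N \<and> int m - int n = k} = N - nat \<bar>k\<bar>"
proof -
  have "bij_betw (\<lambda>j. if 0 \<le> k then (j + nat k, j) else (j, j + nat (- k))) {..<N - nat \<bar>k\<bar>}
      {(m, n). m < N \<and> n < N \<and> int m - int n = k}"
    by (rule bij_betw_byWitness[where f' = "\<lambda>(m, n). min m n"]) (auto split: if_splits)
  then show ?thesis by (simp flip: bij_betw_same_card)
qed

text \<open>Grouping the pairs \<open>(m, n)\<close> by their difference \<open>k\<close> turns this into the usual Fejer mean
  \<open>\<Sum>\<^sub>k (1 - |k| / N) f k exp (i k x)\<close>.  The double sum is kept because it shows the mean to be a value of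
  the Toeplitz form of \<open>f\<close>, hence non-negative.\<close>

definition fejer :: "formal_fourier_series \<Rightarrow> nat \<Rightarrow> real \<Rightarrow> complex" where
  "fejer f N x = (\<Sum>m<N. \<Sum>n<N. f (int m - int n) * exp (\<i> * of_int (int m - int n) * of_real x)) / of_nat N"

lemma continuous_on_fejer: "continuous_on A (fejer f N)"
  unfolding fejer_def divide_inverse by (intro continuous_intros)

lemma fejer_real:
  assumes "\<And>n. f (- n) = cnj (f n)"
  shows "cnj (fejer f N x) = fejer f N x"
proof -
  have "cnj (f (int m - int n)) = f (int n - int m)" for m n
    using assms[of "int m - int n"] by simp
  moreover have "cnj (exp (\<i> * of_int (int m - int n) * of_real x)) = exp (\<i> * of_int (int n - int m) * of_real x)" for m n
    by (simp add: exp_cnj algebra_simps)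
  ultimately show ?thesis
    unfolding fejer_def by (subst sum.swap) (simp add: cnj_sum del: of_int_diff)
qed

lemma fejer_nonneg:
  assumes "positive_definite_kernel (\<lambda>m n :: nat. f (int m - int n))"
  shows "0 \<le> Re (fejer f N x)"
proof -
  define c where "c n = exp (- (\<i> * of_nat n * of_real x))" for n
  have "cnj (c m) * c n = exp (\<i> * of_int (int m - int n) * of_real x)" for m n
    by (simp add: c_def exp_cnj algebra_simps flip: exp_add)
  then have e: "f (int m - int n) * exp (\<i> * of_int (int m - int n) * of_real x) = cnj (c m) * f (int m - int n) * c n" for m n
    by (metis mult.assoc mult.commute)
  have "fejer f N x = (\<Sum>m<N. \<Sum>n<N. cnj (c m) * f (int m - int n) * c n) / of_nat N"
    unfolding fejer_def e ..
  then show ?thesis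
    using positive_definite_kernel_quadratic_form[OF assms, of "{..<N}" c] by simp
qed

text \<open>By orthogonality only the pairs with \<open>m - n = k\<close> survive, and \<open>card_diff_eq\<close> counts them.\<close>

lemma fejer_coefficient:
  fixes f :: formal_fourier_series
  shows "(LINT x:{0..2 * pi}|lborel. exp (- (\<i> * of_int k * of_real x)) * fejer f N x)
    = 2 * pi * f k * of_real (real (N - nat \<bar>k\<bar>) / real N)"
proof -
  let ?e = "\<lambda>j x. exp (\<i> * of_int j * complex_of_real x)"
  have int: "set_integrable lborel {0..2 * pi} (\<lambda>x. c * ?e j x)" for c j
    by (intro borel_integrable_atLeastAtMost' continuous_intros)
  define c where "c m n = f (int m - int n) / of_nat N" for m n
  have "exp (- (\<i> * of_int k * of_real x)) * fejer f N x
      = (\<Sum>m<N. \<Sum>n<N. c m n * ?e (int m - int n - k) x)" for x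
    by (simp add: c_def fejer_def sum_distrib_left sum_divide_distrib algebra_simps flip: exp_add)
  then have expand: "indicator {0..2 * pi} x *\<^sub>R (exp (- (\<i> * of_int k * of_real x)) * fejer f N x)
      = (\<Sum>m<N. \<Sum>n<N. indicator {0..2 * pi} x *\<^sub>R (c m n * ?e (int m - int n - k) x))" for x :: real
    by (simp only: scaleR_sum_right)
  have "(LINT x:{0..2 * pi}|lborel. exp (- (\<i> * of_int k * of_real x)) * fejer f N x)
      = (\<Sum>m<N. \<Sum>n<N. LINT x:{0..2 * pi}|lborel. c m n * ?e (int m - int n - k) x)"
    unfolding set_lebesgue_integral_def expand
    by (simp only: Bochner_Integration.integral_sum Bochner_Integration.integrable_sum
        int[unfolded set_integrable_def])
  also have "\<dots> = (\<Sum>m<N. \<Sum>n<N. if int m - int n = k then 2 * pi * f k / of_nat N else 0)"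
    by (intro sum.cong refl) (auto simp: c_def integral_trig_period simp del: of_int_diff)
  also have "\<dots> = (\<Sum>(m, n)\<in>{..<N} \<times> {..<N}. if int m - int n = k then 2 * pi * f k / of_nat N else 0)"
    by (rule sum.cartesian_product)
  also have "\<dots> = (\<Sum>p\<in>{(m, n). m < N \<and> n < N \<and> int m - int n = k}. 2 * pi * f k / of_nat N)"
    by (rule sum.mono_neutral_cong_right) (auto split: if_splits)
  also have "\<dots> = 2 * pi * f k * of_real (real (N - nat \<bar>k\<bar>) / real N)"
    by (simp add: card_diff_eq)
  finally show ?thesis .
qed

section \<open>Positive definite sequences and Herglotz's theorem\<close>

lemma positive_definite_sequence_cnj:
  assumes "positive_definite_kernel (\<lambda>m n :: nat. f (int m - int n))"
  shows "f (- k) = cnj (f k)"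
proof -
  have "int (nat k) - int (nat (- k)) = k" "int (nat (- k)) - int (nat k) = - k" by simp_all
  then show ?thesis
    using positive_definite_kernel_hermitian[OF assms, of "nat (- k)" "nat k"] by metis
qed

lemma positive_definite_sequence_real_0:
  assumes "positive_definite_kernel (\<lambda>m n :: nat. f (int m - int n))"
  shows "complex_of_real (Re (f 0)) = f 0"
proof -
  have "Im (f (- 0)) = Im (cnj (f 0))"
    by (rule arg_cong[OF positive_definite_sequence_cnj[OF assms]])
  then have "Im (f 0) = 0" by simp
  then show ?thesis by (simp add: complex_eq_iff)
qed

text \<open>The total mass of the measure to be constructed is \<open>f 0\<close>; when it vanishes, no normalisation is
  possible and the measure has to be \<open>0\<close>.  The two-point vector with entries \<open>- cnj (f j)\<close> at \<open>0\<close> and \<open>1\<close>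
  at \<open>j\<close> gives the form the value \<open>- 2 |f j|\<^sup>2\<close>.\<close>

lemma positive_definite_sequence_zero:
  assumes pd: "positive_definite_kernel (\<lambda>m n :: nat. f (int m - int n))" and "f 0 = 0"
  shows "f k = 0"
proof -
  have nat: "f (int j) = 0" for j
  proof (cases "j = 0")
    case False
    have herm: "f (- int j) = cnj (f (int j))"
      by (rule positive_definite_sequence_cnj[OF pd])
    define c where "c n = (if n = 0 then - cnj (f (int j)) else 1)" for n :: nat
    have "0 \<le> Re (\<Sum>m\<in>{0, j}. \<Sum>n\<in>{0, j}. cnj (c m) * f (int m - int n) * c n)"
      by (rule positive_definite_kernel_quadratic_form[OF pd]) simp
    also have "\<dots> = - 2 * (cmod (f (int j)))\<^sup>2"
      using False \<open>f 0 = 0\<close> unfolding cmod_power2 by (simp add: c_def herm power2_eq_square)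
    finally show ?thesis by simp
  qed (simp add: \<open>f 0 = 0\<close>)
  show ?thesis
  proof (cases "0 \<le> k")
    case True
    then show ?thesis using nat[of "nat k"] by simp
  next
    case False
    then show ?thesis
      using nat[of "nat (- k)"] positive_definite_sequence_cnj[OF pd, of "- k"] by simp
  qed
qed

definition fejer_measure :: "formal_fourier_series \<Rightarrow> nat \<Rightarrow> real measure" where
  "fejer_measure f N = density lborel
     (\<lambda>x. ennreal (indicator {0..2 * pi} x * (Re (fejer f N x) / (2 * pi * Re (f 0)))))"

lemma sets_fejer_measure [simp]: "sets (fejer_measure f N) = sets borel"
  and space_fejer_measure [simp]: "space (fejer_measure f N) = UNIV"
  by (simp_all add: fejer_measure_def)

lemma fejer_measurable [measurable]: "fejer f N \<in> borel_measurable borel"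
  by (rule borel_measurable_continuous_onI) (rule continuous_on_fejer)

text \<open>The Fejer densities are probability measures carried by one period, and their coefficients tend to
  those of \<open>f\<close>, up to the factor \<open>f 0\<close>.  The total mass is the coefficient at \<open>k = 0\<close>.\<close>

lemma
  assumes pd: "positive_definite_kernel (\<lambda>m n :: nat. f (int m - int n))"
    and f0: "0 < Re (f 0)" and N: "0 < N"
  shows integral_fejer_measure:
      "(LINT x|fejer_measure f N. exp (- (\<i> * of_int k * of_real x)))
        = f k / f 0 * of_real (real (N - nat \<bar>k\<bar>) / real N)"
    and real_distribution_fejer_measure: "real_distribution (fejer_measure f N)"
    and measure_fejer_measure_Icc: "measure (fejer_measure f N) {0..2 * pi} = 1"
proof -
  let ?d = "\<lambda>x. indicator {0..2 * pi} x * (Re (fejer f N x) / (2 * pi * Re (f 0)))"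
  note herm = positive_definite_sequence_cnj[OF pd] and f0' = positive_definite_sequence_real_0[OF pd]
  have fejer: "of_real (Re (fejer f N x)) = fejer f N x" for x
    using arg_cong[OF fejer_real[of f N x, OF herm], of Im] by (simp add: complex_eq_iff)
  have d_nonneg: "0 \<le> ?d x" for x
    using fejer_nonneg[OF pd, of N x] f0 by simp
  show coeff: "(LINT x|fejer_measure f N. exp (- (\<i> * of_int k * of_real x)))
        = f k / f 0 * of_real (real (N - nat \<bar>k\<bar>) / real N)" for k
  proof -
    have "(LINT x|fejer_measure f N. exp (- (\<i> * of_int k * of_real x)))
        = (LINT x|lborel. ?d x *\<^sub>R exp (- (\<i> * of_int k * of_real x)))"
      unfolding fejer_measure_def using d_nonneg
      by (intro integral_density AE_I2) (auto intro!: borel_measurable_continuous_onI continuous_intros)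
    also have "\<dots> = (LINT x|lborel. (indicator {0..2 * pi} x *\<^sub>R
        (exp (- (\<i> * of_int k * of_real x)) * fejer f N x)) / (2 * pi * f 0))"
      by (intro Bochner_Integration.integral_cong refl)
        (simp add: scaleR_conv_of_real fejer f0' mult_ac)
    also have "\<dots> = (2 * pi * f k * of_real (real (N - nat \<bar>k\<bar>) / real N)) / (2 * pi * f 0)"
      using fejer_coefficient[of k f N] by (simp add: set_lebesgue_integral_def)
    finally show ?thesis by simp
  qed
  have "set_integrable lborel {0..2 * pi} (\<lambda>x. Re (fejer f N x) / (2 * pi * Re (f 0)))"
    using f0 by (intro borel_integrable_atLeastAtMost' continuous_intros continuous_on_fejer) auto
  then have d_integrable: "integrable lborel ?d" by (simp add: set_integrable_def)
  have "emeasure (fejer_measure f N) UNIV = (\<integral>\<^sup>+ x. ennreal (?d x) \<partial>lborel)"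
    unfolding fejer_measure_def by (subst emeasure_density) simp_all
  also have "\<dots> = ennreal (LINT x|lborel. ?d x)"
    by (rule nn_integral_eq_integral[OF d_integrable]) (intro AE_I2 d_nonneg)
  finally have "emeasure (fejer_measure f N) UNIV = ennreal (LINT x|lborel. ?d x)" .
  then interpret finite_measure "fejer_measure f N" by (intro finite_measureI) simp
  have "of_real (measure (fejer_measure f N) UNIV) = (1 :: complex)"
    using coeff[of 0] f0 N by (auto simp: scaleR_conv_of_real)
  then have total: "measure (fejer_measure f N) UNIV = 1"
    using of_real_eq_1_iff by blast
  then have "prob_space (fejer_measure f N)"
    by (intro prob_spaceI) (simp add: emeasure_eq_measure)
  then show "real_distribution (fejer_measure f N)"
    by (intro real_distribution.intro real_distribution_axioms.intro) auto
  have "emeasure (fejer_measure f N) (- {0..2 * pi})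
      = (\<integral>\<^sup>+ x. ennreal (?d x) * indicator (- {0..2 * pi}) x \<partial>lborel)"
    unfolding fejer_measure_def by (subst emeasure_density) simp_all
  also have "\<dots> = (\<integral>\<^sup>+ (x::real). 0 \<partial>lborel)"
    by (intro nn_integral_cong) (simp split: split_indicator)
  finally have "measure (fejer_measure f N) (- {0..2 * pi}) = 0"
    by (simp add: measure_def)
  then show "measure (fejer_measure f N) {0..2 * pi} = 1"
    using finite_measure_compl[of "{0..2 * pi}"] total by (simp add: Compl_eq_Diff_UNIV)
qed

text \<open>The measures \<open>\<nu> N\<close> live on the line, so that Helly's theorem and the continuity of characteristic
  functions under weak convergence apply; the Fourier coefficients are the values of the characteristic
  function at integers.  It does not matter where the mass of the weak limit lies, because the
  projection to the torus respects the integer frequencies.\<close>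

theorem herglotz:
  assumes pd: "positive_definite_kernel (\<lambda>m n :: nat. f (int m - int n))"
  shows "\<exists>\<mu>. radon_measure \<mu> \<and> represents_measure f \<mu>"
proof (cases "f 0 = 0")
  case True
  let ?\<mu> = "distr (null_measure (borel :: real measure)) borel abs_torus"
  have "radon_measure ?\<mu>"
    by (intro radon_measure_distr continuous_on_abs_torus finite_measureI) auto
  moreover have "represents_measure f ?\<mu>"
    unfolding represents_measure_def
  proof
    fix k
    have "(LINT t|?\<mu>. torus_exp (- k) t)
        = (LINT x|null_measure borel. torus_exp (- k) (abs_torus x))"
      using borel_measurable_continuous_onI[OF continuous_on_abs_torus] torus_exp_measurable
      by (intro integral_distr) auto
    then show "f k = (LINT t|?\<mu>. torus_exp (- k) t)"
      using positive_definite_sequence_zero[OF pd True] by simp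
  qed
  ultimately show ?thesis by blast
next
  case False
  have "0 \<le> Re (f 0)"
    using positive_definite_kernel_quadratic_form[OF pd, of "{0}" "\<lambda>_. 1"] by simp
  moreover note real = positive_definite_sequence_real_0[OF pd]
  ultimately have f0: "0 < Re (f 0)" using False by (cases "Re (f 0) = 0") auto
  define \<nu> where "\<nu> N = fejer_measure f (Suc N)" for N
  have \<nu>: "real_distribution (\<nu> N)" for N
    unfolding \<nu>_def by (rule real_distribution_fejer_measure[OF pd f0]) simp
  \<comment> \<open>Any bounded half-open interval containing \<open>[0, 2\<pi>]\<close> would do.\<close>
  have mass: "1 \<le> measure (\<nu> N) {- 1<..7}" for N
  proof -
    interpret real_distribution "\<nu> N" by (rule \<nu>)
    have "1 = measure (\<nu> N) {0..2 * pi}"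
      unfolding \<nu>_def by (rule measure_fejer_measure_Icc[OF pd f0, symmetric]) simp
    also have "\<dots> \<le> measure (\<nu> N) {- 1<..7}"
      using pi_less_4 pi_approx by (intro finite_measure_mono) auto
    finally show ?thesis .
  qed
  have "tight \<nu>"
    unfolding tight_def
  proof (intro conjI allI impI)
    show "\<exists>a b. a < b \<and> (\<forall>N. 1 - \<epsilon> < measure (\<nu> N) {a<..b})" if "0 < \<epsilon>" for \<epsilon> :: real
    proof (rule exI[of _ "- 1"], rule exI[of _ 7], intro conjI allI)
      show "1 - \<epsilon> < measure (\<nu> N) {- 1<..7}" for N using mass[of N] that by linarith
    qed simp
  qed (rule \<nu>)
  then obtain r M where r: "strict_mono r" and M: "real_distribution M"
    and conv: "weak_conv_m (\<nu> \<circ> r) M"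
    using tight_imp_convergent_subsubsequence[of \<nu> id] by (auto simp: strict_mono_id)
  interpret M: real_distribution M by (rule M)
  have char_\<nu>: "char (\<nu> N) (of_int (- k)) = f k / f 0 * of_real (real (Suc N - nat \<bar>k\<bar>) / real (Suc N))" for N k
    using integral_fejer_measure[OF pd f0, of "Suc N" k] by (simp add: char_def \<nu>_def mult_ac)
  have char_M: "char M (of_int (- k)) = f k / f 0" for k
  \<comment> \<open>Weak convergence gives one value of the limit, the Fejer weights \<open>1 - |k| / N\<close> the other.\<close>
  proof (rule LIMSEQ_unique)
    show "(\<lambda>N. char ((\<nu> \<circ> r) N) (of_int (- k))) \<longlonglongrightarrow> char M (of_int (- k))"
      using \<nu> by (intro levy_continuity1 M conv) simp
    have "(\<lambda>N. 1 - real (nat \<bar>k\<bar>) / real (Suc N)) \<longlonglongrightarrow> 1 - 0"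
      by (intro tendsto_diff tendsto_const LIMSEQ_Suc[OF lim_const_over_n])
    then have "(\<lambda>N. real (Suc N - nat \<bar>k\<bar>) / real (Suc N)) \<longlonglongrightarrow> 1 - 0"
    proof (rule Lim_transform_eventually)
      show "\<forall>\<^sub>F N in sequentially.
          1 - real (nat \<bar>k\<bar>) / real (Suc N) = real (Suc N - nat \<bar>k\<bar>) / real (Suc N)"
        using eventually_ge_at_top[of "nat \<bar>k\<bar>"]
        by eventually_elim (simp add: of_nat_diff diff_divide_distrib del: of_nat_Suc)
    qed
    then have "(\<lambda>N. char (\<nu> N) (of_int (- k))) \<longlonglongrightarrow> f k / f 0 * of_real (1 - 0)"
      unfolding char_\<nu> by (intro tendsto_intros)
    from LIMSEQ_subseq_LIMSEQ[OF this r]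
    show "(\<lambda>N. char ((\<nu> \<circ> r) N) (of_int (- k))) \<longlonglongrightarrow> f k / f 0"
      by (simp add: o_def)
  qed
  define \<mu> where "\<mu> = distr (density M (\<lambda>_. ennreal (Re (f 0)))) borel abs_torus"
  have abs_torus: "abs_torus \<in> borel_measurable M"
    using borel_measurable_continuous_onI[OF continuous_on_abs_torus] by simp
  have "radon_measure \<mu>"
    unfolding \<mu>_def
    by (intro radon_measure_distr continuous_on_abs_torus finite_measureI)
      (auto simp: emeasure_density_const M.emeasure_eq_measure ennreal_mult_eq_top_iff)
  moreover have "represents_measure f \<mu>"
    unfolding represents_measure_def
  proof
    fix k
    have "(LINT t|\<mu>. torus_exp (- k) t) = (LINT x|density M (\<lambda>_. ennreal (Re (f 0))). torus_exp (- k) (abs_torus x))"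
      unfolding \<mu>_def using abs_torus torus_exp_measurable by (intro integral_distr) auto
    also have "\<dots> = (LINT x|M. Re (f 0) *\<^sub>R torus_exp (- k) (abs_torus x))"
      using f0 abs_torus torus_exp_measurable by (intro integral_density) auto
    also have "\<dots> = Re (f 0) *\<^sub>R (LINT x|M. torus_exp (- k) (abs_torus x))"
      by simp
    also have "(LINT x|M. torus_exp (- k) (abs_torus x)) = char M (of_int (- k))"
      by (simp add: char_def torus_exp.abs_eq mult_ac)
    also have "Re (f 0) *\<^sub>R \<dots> = f k"
      unfolding char_M using False real by (simp add: scaleR_conv_of_real)
    finally show "f k = (LINT t|\<mu>. torus_exp (- k) t)" ..
  qed
  ultimately show ?thesis by blast
qed

section \<open>Positive definiteness characterises positive measures\<close>

theorem theorem1p12: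
  fixes a :: "complex ^ 'q::finite" and f :: formal_fourier_series
  assumes "CARD('q) \<ge> 2"
    and "a \<in> unit_sphere"
  shows "positive_definite_kernel (Gamma_kernel a f) \<longleftrightarrow>
           (\<exists>\<mu>. radon_measure \<mu> \<and> represents_measure f \<mu>)"
proof
  assume "positive_definite_kernel (Gamma_kernel a f)"
  with assms(2) show "\<exists>\<mu>. radon_measure \<mu> \<and> represents_measure f \<mu>"
    by (intro herglotz Gamma_pd_imp_Toeplitz_pd)
next
  assume "\<exists>\<mu>. radon_measure \<mu> \<and> represents_measure f \<mu>"
  with assms(2) show "positive_definite_kernel (Gamma_kernel a f)"
    by (blast intro: measure_imp_Gamma_pd)
qed

end
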